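(* Let $k>1$ and $n\ge1$ be integers and let $x_{ij}$ ($1\le i\le k$, $1\le j\le n$) be non-negative integers. Put $$s_n=\frac1n\sum_{j=1}^n\sum_{i=1}^kx_{ij},\qquad z_n=\frac1n\sum_{j=1}^n\sum_{i=1}^k(i-1)x_{ij},$$ $$a_n=-s_n-z_n+ks_n,\quad b_n=-z_n+ks_n,\quad c_n=z_n+s_n,\quad d_n=z_n.$$ The function $$f(y)=a_ny^{k+1}-b_ny^k+c_ny-d_n$$ has one zero in the open interval $(0,1)$ when the inflection point $y_{i.p.}$ satisfies the inequality $$y_{i.p.}:=\frac{b_n(k-1)}{a_n(k+1)}<1,$$ and no zeros in $(0,1)$ when $y_{i.p.}\ge1$.
   Context: The $x_{ij}$ are the observed counts of neutrons at layer $i$ of a $k$-layer detector in experiment round $j$. The equation $f(y)=0$ is the one satisfied by $y=1-\hat p_n$, where $\hat p_n$ is the maximum likelihood estimator of the absorption probability $p$ in the model where the counts are independent Poisson variables with means $p(1-p)^{i-1}\lambda t$ ($\lambda$ the beam intensity, $t$ the duration of each experiment).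
   Formalization: Assumes a_n ≠ 0, so that y_{i.p.} is defined, and, for the first claim only, z_n > 0: if all counts lie in layer 1 (z_n = 0), then y_{i.p.} = k/(k+1) < 1 but f > 0 on (0,1), so f has no zero there. *)

theory Defs
  imports Complex_Main
begin

text \<open>
  The count in layer \<open>i\<close> and round \<open>j\<close> is \<open>x i j\<close>; only the values with
  \<open>1 \<le> i \<le> k\<close> and \<open>1 \<le> j \<le> n\<close> are used.
\<close>

definition s_stat :: "nat \<Rightarrow> nat \<Rightarrow> (nat \<Rightarrow> nat \<Rightarrow> nat) \<Rightarrow> real" where
  "s_stat k n x = 1 / real n * (\<Sum>j=1..n. \<Sum>i=1..k. real (x i j))"

definition z_stat :: "nat \<Rightarrow> nat \<Rightarrow> (nat \<Rightarrow> nat \<Rightarrow> nat) \<Rightarrow> real" where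
  "z_stat k n x = 1 / real n * (\<Sum>j=1..n. \<Sum>i=1..k. (real i - 1) * real (x i j))"

definition a_coef :: "nat \<Rightarrow> nat \<Rightarrow> (nat \<Rightarrow> nat \<Rightarrow> nat) \<Rightarrow> real" where
  "a_coef k n x = - s_stat k n x - z_stat k n x + real k * s_stat k n x"

definition b_coef :: "nat \<Rightarrow> nat \<Rightarrow> (nat \<Rightarrow> nat \<Rightarrow> nat) \<Rightarrow> real" where
  "b_coef k n x = - z_stat k n x + real k * s_stat k n x"

definition c_coef :: "nat \<Rightarrow> nat \<Rightarrow> (nat \<Rightarrow> nat \<Rightarrow> nat) \<Rightarrow> real" where
  "c_coef k n x = z_stat k n x + s_stat k n x"

definition d_coef :: "nat \<Rightarrow> nat \<Rightarrow> (nat \<Rightarrow> nat \<Rightarrow> nat) \<Rightarrow> real" where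
  "d_coef k n x = z_stat k n x"

definition f_fun :: "nat \<Rightarrow> nat \<Rightarrow> (nat \<Rightarrow> nat \<Rightarrow> nat) \<Rightarrow> real \<Rightarrow> real" where
  "f_fun k n x y =
     a_coef k n x * y ^ (k + 1) - b_coef k n x * y ^ k + c_coef k n x * y - d_coef k n x"

text \<open>
  The quotient is meaningful only if \<open>a_coef k n x \<noteq> 0\<close>, that is, unless every count
  outside layer \<open>k\<close> vanishes; otherwise \<open>f_fun k n x\<close> has no such inflection point and
  division by zero would return the spurious value \<open>0\<close>.

  When \<open>z_stat k n x = 0\<close> (every count outside layer \<open>1\<close> vanishes) and
  \<open>s_stat k n x = s > 0\<close>, one has \<open>y_ip k n x = k / (k + 1) < 1\<close>, but
  \<open>f_fun k n x y = s * y * ((k - 1) * y ^ k - k * y ^ (k - 1) + 1)\<close> is positive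
  on \<open>(0, 1)\<close>: the zero has moved to the end point \<open>y = 0\<close>.
  Existence of a zero in the open interval thus needs \<open>z_stat k n x > 0\<close>.
\<close>

definition y_ip :: "nat \<Rightarrow> nat \<Rightarrow> (nat \<Rightarrow> nat \<Rightarrow> nat) \<Rightarrow> real" where
  "y_ip k n x = b_coef k n x * (real k - 1) / (a_coef k n x * (real k + 1))"

end

theory Submission
  imports Defs
begin

text \<open>
  Both \<open>f\<close> and its derivative vanish at \<open>1\<close>, and the second derivative is
  \<open>k * y ^ (k - 2) * ((k + 1) * a * y - (k - 1) * b)\<close> with \<open>a, b > 0\<close>, so it changes sign
  only at the inflection point, from negative to positive. To the right of the inflection point
  \<open>f\<close> lies above its tangent at \<open>1\<close>, hence is positive on the part below \<open>1\<close>. To the left of it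
  \<open>f\<close> is strictly concave, and it passes from \<open>f 0 = - z < 0\<close> to a positive value, which
  leaves room for exactly one zero. If the inflection point is not below \<open>1\<close>, then
  \<open>f\<close> is strictly concave on \<open>[0, 1]\<close> and lies below its tangent at \<open>1\<close>.
\<close>

text \<open>\<open>f'\<close> decreases strictly to \<open>f' r = 0\<close>, so it is positive left
  of \<open>r\<close>, and \<open>f\<close> climbs strictly to \<open>f r = 0\<close>. The sign of
  \<open>f''\<close> is asked for only inside the interval because it may vanish at either end,
  namely at the inflection point.\<close>

lemma concave_below_horizontal_tangent:
  fixes f f' f'' :: "real \<Rightarrow> real"
  assumes f': "\<And>x. DERIV f x :> f' x" and f'': "\<And>x. DERIV f' x :> f'' x"
    and "f r = 0" "f' r = 0"
    and neg: "\<And>x. y < x \<Longrightarrow> x < r \<Longrightarrow> f'' x < 0"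
    and "y < r"
  shows "f y < 0"
proof -
  have "0 < f' x" if "y < x" "x < r" for x
  proof -
    have "f' r < f' x"
      using that(2)
    proof (rule DERIV_neg_imp_decreasing_open)
      show "continuous_on {x..r} f'"
        by (intro DERIV_continuous_on[OF has_field_derivative_at_within[OF f'']])
      show "\<exists>d. DERIV f' t :> d \<and> d < 0" if "x < t" "t < r" for t
        using f''[of t] neg[of t] that \<open>y < x\<close> by auto
    qed
    then show ?thesis using \<open>f' r = 0\<close> by simp
  qed
  moreover have "continuous_on {y..r} f"
    by (intro DERIV_continuous_on[OF has_field_derivative_at_within[OF f']])
  ultimately have "f y < f r"
    using f' by (metis DERIV_pos_imp_increasing_open[OF \<open>y < r\<close>])
  then show ?thesis using \<open>f r = 0\<close> by simp
qed

text \<open>Existence is the intermediate value theorem. Two zeros would give a critical point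
  between them and, since \<open>f r\<close> is positive, a later point with positive slope,
  although \<open>f'\<close> decreases.\<close>

lemma concave_sign_change_unique_zero:
  fixes f f' f'' :: "real \<Rightarrow> real"
  assumes f': "\<And>x. DERIV f x :> f' x" and f'': "\<And>x. DERIV f' x :> f'' x"
    and neg: "\<And>x. l < x \<Longrightarrow> x < r \<Longrightarrow> f'' x < 0"
    and "l < r" "f l < 0" "0 < f r"
  shows "\<exists>!x. x \<in> {l<..<r} \<and> f x = 0"
proof -
  have cont: "continuous_on A f" for A
    by (intro DERIV_continuous_on[OF has_field_derivative_at_within[OF f']])
  obtain x where "l \<le> x" "x \<le> r" "f x = 0"
    using IVT'[of f l 0 r] cont assms(4-6) by (metis less_imp_le)
  then have ex: "x \<in> {l<..<r} \<and> f x = 0"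
    using assms(5,6) by (auto simp: less_le)
  have no_two: False if uv: "l < u" "u < v" "v < r" "f u = 0" "f v = 0" for u v
  proof -
    obtain p where p: "u < p" "p < v" "f v - f u = (v - u) * f' p"
      using MVT2[OF \<open>u < v\<close>, of f f'] f' by blast
    obtain q where q: "v < q" "q < r" "f r - f v = (r - v) * f' q"
      using MVT2[OF \<open>v < r\<close>, of f f'] f' by blast
    have "f' p = 0" using p uv by simp
    moreover have "0 < f' q"
      using q uv \<open>0 < f r\<close> by (simp add: zero_less_mult_iff)
    moreover have "p < q" using p q by simp
    then have "f' q < f' p"
    proof (rule DERIV_neg_imp_decreasing)
      show "\<exists>d. DERIV f' t :> d \<and> d < 0" if "p \<le> t" "t \<le> q" for t
        using f''[of t] neg[of t] that p q uv by auto
    qed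
    ultimately show False by simp
  qed
  show ?thesis
  proof (rule ex1I)
    show "x \<in> {l<..<r} \<and> f x = 0" by (fact ex)
    fix w assume "w \<in> {l<..<r} \<and> f w = 0"
    then show "w = x"
      using no_two[of w x] no_two[of x w] ex by (cases w x rule: linorder_cases) auto
  qed
qed

lemma z_stat_nonneg: "0 \<le> z_stat k n x"
  unfolding z_stat_def by (intro mult_nonneg_nonneg sum_nonneg) auto

lemma a_coef_nonneg: "0 \<le> a_coef k n x"
proof -
  \<comment> \<open>In \<open>a_coef\<close> the count \<open>x i j\<close> gets weight
    \<open>k - 1 - (i - 1) = k - i\<close>, which is nonnegative.\<close>
  have "a_coef k n x = 1 / real n * (\<Sum>j=1..n. \<Sum>i=1..k. (real k - real i) * real (x i j))"
    unfolding a_coef_def s_stat_def z_stat_def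
    by (simp add: algebra_simps sum.distrib sum_subtractf sum_distrib_left)
  also have "\<dots> \<ge> 0"
    by (intro mult_nonneg_nonneg sum_nonneg) auto
  finally show ?thesis .
qed

theorem lemma2:
  fixes k n :: nat and x :: "nat \<Rightarrow> nat \<Rightarrow> nat"
  assumes "k > 1" and "n \<ge> 1"
    and "a_coef k n x \<noteq> 0"
  shows "(z_stat k n x > 0 \<and> y_ip k n x < 1 \<longrightarrow>
            (\<exists>!y. y \<in> {0<..<1} \<and> f_fun k n x y = 0)) \<and>
         (y_ip k n x \<ge> 1 \<longrightarrow>
            (\<forall>y \<in> {0<..<1}. f_fun k n x y \<noteq> 0))"
proof -
  define a b c d p f where "a = a_coef k n x" and "b = b_coef k n x" and "c = c_coef k n x"
    and "d = d_coef k n x" and "p = y_ip k n x" and "f = f_fun k n x"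
  define f' where "f' y = a * (real k + 1) * y ^ k - b * real k * y ^ (k - 1) + c" for y
  define f'' where "f'' y = real k * y ^ (k - 2) * ((real k + 1) * a * y - (real k - 1) * b)" for y
  \<comment> \<open>This form removes the truncated subtractions in the exponents
    \<open>k - 1\<close> and \<open>k - 2\<close>.\<close>
  obtain m where k: "k = Suc (Suc m)"
    using \<open>k > 1\<close> by (auto dest: less_imp_Suc_add)
  have f_eq: "f y = a * y ^ (k + 1) - b * y ^ k + c * y - d" for y
    by (simp add: f_def f_fun_def a_def b_def c_def d_def)
  have DERIV_f: "DERIV f y :> f' y" for y
    unfolding f_eq[abs_def] f'_def k
    by (rule derivative_eq_intros refl)+ (simp add: algebra_simps)
  have DERIV_f': "DERIV f' y :> f'' y" for y
    unfolding f'_def[abs_def] f''_def k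
    by (rule derivative_eq_intros refl)+ (simp add: algebra_simps)
  have f_1: "f 1 = 0"
    by (simp add: f_eq a_def b_def c_def d_def a_coef_def b_coef_def c_coef_def d_coef_def)
  have f'_1: "f' 1 = 0"
    by (simp add: f'_def a_def b_def c_def a_coef_def b_coef_def c_coef_def algebra_simps)
  have a_pos: "0 < a"
    using a_coef_nonneg[of k n x] assms(3) by (simp add: a_def)
  \<comment> \<open>The product equals \<open>a + z_stat k n x\<close>; below,
    \<open>b = a + s_stat k n x\<close>.\<close>
  have "0 < (real k - 1) * s_stat k n x"
    using a_pos z_stat_nonneg[of k n x] by (simp add: a_def a_coef_def algebra_simps)
  then have "0 < s_stat k n x"
    using \<open>k > 1\<close> by (simp add: zero_less_mult_iff)
  then have b_pos: "0 < b"
    using a_pos by (simp add: a_def b_def a_coef_def b_coef_def)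
  have p_pos: "0 < p"
    using a_pos b_pos \<open>k > 1\<close> by (simp add: p_def y_ip_def flip: a_def b_def)
  \<comment> \<open>Trading \<open>b\<close> for \<open>p\<close> makes \<open>f''\<close> a
    multiple of \<open>y - p\<close> with a factor positive for positive \<open>y\<close>.\<close>
  have b_eq: "(real k - 1) * b = (real k + 1) * a * p"
    using a_pos by (simp add: p_def y_ip_def flip: a_def b_def)
  have f''_eq: "f'' y = real k * y ^ (k - 2) * (a * (real k + 1)) * (y - p)" for y
    unfolding f''_def b_eq by (simp add: algebra_simps)
  have factor_pos: "0 < real k * y ^ (k - 2) * (a * (real k + 1))" if "0 < y" for y
    using that a_pos \<open>k > 1\<close> by simp
  have f''_neg: "f'' y < 0" if "0 < y" "y < p" for y
    unfolding f''_eq using that by (intro mult_pos_neg[OF factor_pos]) auto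
  have f''_pos: "0 < f'' y" if "p < y" for y
    unfolding f''_eq using that p_pos by (intro mult_pos_pos[OF factor_pos]) auto
  have "\<exists>!y. y \<in> {0<..<1} \<and> f y = 0" if "0 < z_stat k n x" "p < 1"
  proof -
    have f_pos: "0 < f y" if "p \<le> y" "y < 1" for y
      \<comment> \<open>Negation turns convexity right of \<open>p\<close> into concavity. The case
        \<open>y = p\<close> supplies the positive end value for the search on (0, p).\<close>
      using concave_below_horizontal_tangent[of "\<lambda>t. - f t" "\<lambda>t. - f' t" "\<lambda>t. - f'' t" 1 y]
        DERIV_f DERIV_f' f_1 f'_1 f''_pos that by (auto intro: DERIV_minus)
    have "f 0 < 0"
      using that(1) by (simp add: f_eq k d_def d_coef_def)
    then have "\<exists>!y. y \<in> {0<..<p} \<and> f y = 0"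
      using concave_sign_change_unique_zero[of f f' f'' 0 p] DERIV_f DERIV_f' f''_neg p_pos
        f_pos[of p] \<open>p < 1\<close> by blast
    moreover have "y \<in> {0<..<p} \<and> f y = 0 \<longleftrightarrow> y \<in> {0<..<1} \<and> f y = 0" for y
      using f_pos[of y] \<open>p < 1\<close> by fastforce
    ultimately show ?thesis by simp
  qed
  moreover have "f y \<noteq> 0" if "1 \<le> p" "y \<in> {0<..<1}" for y
    using concave_below_horizontal_tangent[of f f' f'' 1 y] DERIV_f DERIV_f' f_1 f'_1 f''_neg that
    by force
  ultimately show ?thesis
    by (auto simp: f_def p_def)
qed

end
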